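(* Let $(\Omega,\mathcal F,\mathbb P)$ be a probability space with $\Omega=E\sqcup E^c$, $\mathbb P(E)=p\in(0,\tfrac12]$, and let $$\mathcal F_1=\{\varnothing,\Omega\},\qquad \mathcal F_n=\mathcal F_\infty=\{\varnothing,E,E^c,\Omega\}\quad(n\ge2).$$ Fix $\lambda>0$ and let $f:=\frac{\lambda}{p}\mathbf 1_E$, so that $\|f\|_1=\lambda$. Assume that $f=g+h+k$ with $g,h,k\in L^1(\mathcal F_\infty)$ and $$0\le k\le\beta\lambda\quad\text{a.s.}$$ for some $\beta\in[0,p^{-1}]$. Then one of the following alternatives holds: (i) $$\mathbb P\Bigl(\sup_{n\ge1}|\mathbb E_n[g]|>0\Bigr)=1;$$ (ii) $g=0$ almost surely and $$\Bigl\|\sum_{n=1}^\infty\bigl|\mathbb E_n[h]-\mathbb E_{n-1}[h]\bigr|\Bigr\|_1\ge\begin{cases}(3-\beta-2p)\lambda,&0\le\beta\le1,\\ 2(1-p\beta)\lambda,&1\le\beta\le p^{-1}.\end{cases}$$ Both lower bounds are sharp: for each $\beta\in[0,p^{-1}]$ there is a decomposition $f=g+h+k$ with $g=0$, $h,k\in L^1(\mathcal F_\infty)$, $0\le k\le\beta\lambda$ a.s., for which equality holds in the corresponding lower bound.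
   Context: $\mathbb E_n:=\mathbb E[\,\cdot\mid\mathcal F_n]$ for $n\ge1$, and $\mathbb E_0\equiv0$ (the zero operator). $L^1(\mathcal F_\infty)$ denotes the $\mathcal F_\infty$-measurable real-valued functions in $L^1(\Omega,\mathbb P)$, and $\|\cdot\|_1$ is the $L^1(\Omega,\mathbb P)$ norm. *)

theory Defs
  imports "HOL-Probability.Probability"
begin

(* Sub-sigma-algebras are represented, as in Conditional_Expectation, by measures of which only
   space and sets matter; F_infinity and F_n below are shown to carry the intended set families. *)

definition F_infinity :: "'a measure \<Rightarrow> 'a set \<Rightarrow> 'a measure" where
  "F_infinity M E = sigma (space M) {{}, E, space M - E, space M}"

(* The index set is {1, 2, ...}; the value at 0 is never used. *)
definition F_filtration :: "'a measure \<Rightarrow> 'a set \<Rightarrow> nat \<Rightarrow> 'a measure" where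
  "F_filtration M E n = (if n \<le> 1 then sigma (space M) {{}, space M} else F_infinity M E)"

definition cond_exp_op ::
  "'a measure \<Rightarrow> (nat \<Rightarrow> 'a measure) \<Rightarrow> nat \<Rightarrow> ('a \<Rightarrow> real) \<Rightarrow> 'a \<Rightarrow> real" where
  "cond_exp_op M F n f = (if n = 0 then (\<lambda>_. 0) else real_cond_exp M (F n) f)"

definition L1_sub :: "'a measure \<Rightarrow> 'a measure \<Rightarrow> ('a \<Rightarrow> real) set" where
  "L1_sub M G = {f. f \<in> borel_measurable G \<and> integrable M f}"

(* The supremum and the series are formed in [0, \<infinity>], so that neither presupposes boundedness
   or convergence. *)
definition max_fun ::
  "'a measure \<Rightarrow> (nat \<Rightarrow> 'a measure) \<Rightarrow> ('a \<Rightarrow> real) \<Rightarrow> 'a \<Rightarrow> ennreal" where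
  "max_fun M F f x = (SUP n\<in>{1..}. ennreal \<bar>cond_exp_op M F n f x\<bar>)"

(* The summation index is shifted: n here is n + 1 in the series over n \<ge> 1. *)
definition variation_fun ::
  "'a measure \<Rightarrow> (nat \<Rightarrow> 'a measure) \<Rightarrow> ('a \<Rightarrow> real) \<Rightarrow> 'a \<Rightarrow> ennreal" where
  "variation_fun M F f x =
     (\<Sum>n. ennreal \<bar>cond_exp_op M F (Suc n) f x - cond_exp_op M F n f x\<bar>)"

lemma sets_F_infinity:
  assumes "E \<in> sets M"
  shows "sets (F_infinity M E) = {{}, E, space M - E, space M}"
proof -
  have E: "E \<subseteq> space M"
    using assms by (rule sets.sets_into_space)
  have "sigma_algebra (space M) {{}, E, space M - E, space M}"
    by (rule sigma_algebra_single_set [OF E])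
  then have "sigma_sets (space M) {{}, E, space M - E, space M} = {{}, E, space M - E, space M}"
    by (rule sigma_algebra.sigma_sets_eq)
  moreover have "{{}, E, space M - E, space M} \<subseteq> Pow (space M)"
    using E by auto
  ultimately show ?thesis
    unfolding F_infinity_def by (simp add: sets_measure_of)
qed

lemma sets_F_filtration:
  assumes "E \<in> sets M"
  shows "sets (F_filtration M E 1) = {{}, space M}"
    and "n \<ge> 2 \<Longrightarrow> sets (F_filtration M E n) = {{}, E, space M - E, space M}"
proof -
  have "sigma_sets (space M) {{}, space M} = {{}, space M}"
    by (rule sigma_algebra.sigma_sets_eq [OF sigma_algebra_trivial])
  then show "sets (F_filtration M E 1) = {{}, space M}"
    by (simp add: F_filtration_def sets_measure_of)
  show "n \<ge> 2 \<Longrightarrow> sets (F_filtration M E n) = {{}, E, space M - E, space M}"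
    by (simp add: F_filtration_def sets_F_infinity [OF assms])
qed

lemma subalgebra_F_filtration:
  assumes "E \<in> sets M"
  shows "subalgebra M (F_filtration M E n)"
  using assms sets.sets_into_space [OF assms]
  by (cases "n \<le> 1")
     (auto simp: subalgebra_def F_filtration_def F_infinity_def space_measure_of_conv
        intro!: sets.sigma_sets_subset)

end

theory Submission
  imports Defs
begin

text \<open>
  An \<open>F_infinity\<close>-measurable function \<open>h\<close> takes a constant value \<open>a\<close> on \<open>E\<close> and \<open>b\<close> off \<open>E\<close>. With
  \<open>m = p a + (1 - p) b\<close> its mean, its maximal function is almost surely \<open>max \<bar>m\<bar> \<bar>h\<bar>\<close> and its variation is
  \<open>\<bar>m\<bar> + \<bar>h - m\<bar>\<close>, of \<open>L\<^sup>1\<close> norm \<open>\<bar>m\<bar> + 2 p (1 - p) \<bar>a - b\<bar>\<close>. A mean-zero function vanishing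
  on \<open>E\<close> or on its complement is zero, whence the dichotomy. If \<open>g = 0\<close> and \<open>k\<close> has values
  \<open>s\<close>, \<open>t\<close>, the norm for \<open>h = f - k\<close> becomes
  \<open>\<bar>lam - p s - (1 - p) t\<bar> + 2 (1 - p) lam - 2 p (1 - p) (s - t)\<close>. For \<open>beta \<le> 1\<close> this is nonincreasing
  in \<open>s\<close> and \<open>t\<close>, so it is minimal at \<open>s = t = beta * lam\<close>; for \<open>beta \<ge> 1\<close> it is minimal when
  \<open>s = beta * lam\<close> and \<open>t\<close> makes the mean of \<open>h\<close> zero.
\<close>

section \<open>Integration and measurability for the partition into \<open>E\<close> and its
  complement\<close>

locale prob_space_event = prob_space +
  fixes E :: "'a set"
  assumes E_sets [measurable]: "E \<in> sets M"
begin

lemma E_subset: "E \<subseteq> space M"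
  using E_sets by (rule sets.sets_into_space)

lemma prob_compl_E: "prob (space M - E) = 1 - prob E"
  by (rule prob_compl [OF E_sets])

lemma has_bochner_integral_two_valued:
  "has_bochner_integral M (\<lambda>x. if x \<in> E then a else b :: real) (prob E * a + (1 - prob E) * b)"
proof -
  have "has_bochner_integral M (\<lambda>x. indicator E x *\<^sub>R a + indicator (space M - E) x *\<^sub>R b)
      (prob E *\<^sub>R a + prob (space M - E) *\<^sub>R b)"
    by (intro has_bochner_integral_add has_bochner_integral_indicator) (auto simp: less_top[symmetric])
  also have "?this \<longleftrightarrow> ?thesis"
    by (intro has_bochner_integral_cong) (auto simp: prob_compl_E)
  finally show ?thesis .
qed

lemma nn_integral_two_valued:
  fixes a b :: real
  assumes "0 \<le> a" "0 \<le> b"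
  shows "(\<integral>\<^sup>+x. ennreal (if x \<in> E then a else b) \<partial>M) = ennreal (prob E * a + (1 - prob E) * b)"
  using nn_integral_eq_integral [of M "\<lambda>x. if x \<in> E then a else b"]
    has_bochner_integral_two_valued [of a b] assms
  by (simp add: has_bochner_integral_iff)

text \<open>Every level set of \<open>u\<close> is one of four sets, none of which separates two
  points of \<open>E\<close> or two points of its complement. Hence \<open>u\<close> is constant on
  each of these two atoms.\<close>

lemma F_infinity_measurable_two_valued:
  fixes u :: "'a \<Rightarrow> real"
  assumes u: "u \<in> borel_measurable (F_infinity M E)"
  obtains a b where "\<And>x. x \<in> space M \<Longrightarrow> u x = (if x \<in> E then a else b)"
proof -
  have sp: "space (F_infinity M E) = space M"
    by (simp add: F_infinity_def space_measure_of_conv)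
  have level: "u -` {c} \<inter> space M \<in> {{}, E, space M - E, space M}" for c
    using measurable_sets [OF u, of "{c}"] sp sets_F_infinity [OF E_sets] by auto
  have atom: "y \<in> A" if "A \<in> {{}, E, space M - E, space M}" "x \<in> A" "y \<in> space M" "x \<in> E \<longleftrightarrow> y \<in> E"
    for A x y
    using that by auto
  have const: "u x = u y" if "x \<in> space M" "y \<in> space M" "x \<in> E \<longleftrightarrow> y \<in> E" for x y
    using atom [OF level [of "u x"], of x y] that by simp
  \<comment> \<open>The value on each atom is read off at a chosen point. If an atom is empty, the
    choice is unspecified, but then its branch is never reached.\<close>
  have "u x = (if x \<in> E then u (SOME x. x \<in> E) else u (SOME x. x \<in> space M - E))"
    if x: "x \<in> space M" for x
  proof (cases "x \<in> E")
    case True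
    then have "(SOME x. x \<in> E) \<in> E"
      by (rule someI)
    then show ?thesis
      using True E_subset const [OF x, of "SOME x. x \<in> E"] by auto
  next
    case False
    with x have "x \<in> space M - E"
      by simp
    then have "(SOME x. x \<in> space M - E) \<in> space M - E"
      by (rule someI)
    then show ?thesis
      using False const [OF x, of "SOME x. x \<in> space M - E"] by simp
  qed
  then show thesis
    by (rule that)
qed

lemma two_valued_L1_sub:
  "(\<lambda>x. if x \<in> E then a else b :: real) \<in> L1_sub M (F_infinity M E)"
proof -
  have [measurable]: "E \<in> sets (F_infinity M E)"
    by (simp add: sets_F_infinity)
  show ?thesis
    using has_bochner_integral_two_valued [of a b]
    by (simp add: L1_sub_def has_bochner_integral_iff)
qed

section \<open>Conditional expectations along the filtration\<close>

lemma sigma_finite_subalgebra_F_filtration: "sigma_finite_subalgebra M (F_filtration M E n)"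
  by (intro finite_measure_subalgebra_is_sigma_finite subalgebra_F_filtration E_sets
      finite_measure_subalgebra.intro finite_measure_subalgebra_axioms.intro) unfold_locales

text \<open>The trivial sigma-algebra leaves two sets to test, and over both of them
  \<open>u\<close> and its mean have the same integral.\<close>

lemma cond_exp_op_1:
  assumes "integrable M u"
  shows "AE x in M. cond_exp_op M (F_filtration M E) 1 u x = expectation u"
proof -
  interpret sigma_finite_subalgebra M "F_filtration M E 1"
    by (rule sigma_finite_subalgebra_F_filtration)
  have "AE x in M. real_cond_exp M (F_filtration M E 1) u x = expectation u"
  proof (rule real_cond_exp_charact)
    fix A assume "A \<in> sets (F_filtration M E 1)"
    then have "A = {} \<or> A = space M"
      using sets_F_filtration(1) [OF E_sets] by auto
    then show "set_lebesgue_integral M A u = set_lebesgue_integral M A (\<lambda>x. expectation u)"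
      by (elim disjE) (simp_all add: set_integral_space assms prob_space, simp add: set_lebesgue_integral_def)
  qed (auto simp: assms)
  then show ?thesis
    by (simp add: cond_exp_op_def)
qed

lemma cond_exp_op_ge_2:
  assumes "u \<in> L1_sub M (F_infinity M E)" "2 \<le> n"
  shows "AE x in M. cond_exp_op M (F_filtration M E) n u x = u x"
proof -
  interpret sigma_finite_subalgebra M "F_filtration M E n"
    by (rule sigma_finite_subalgebra_F_filtration)
  have "F_filtration M E n = F_infinity M E"
    using assms(2) by (simp add: F_filtration_def)
  then show ?thesis
    using real_cond_exp_F_meas [of u] assms by (simp add: L1_sub_def cond_exp_op_def)
qed

section \<open>Maximal function and variation of a two-valued function\<close>

lemma borel_measurable_max_fun [measurable]:
  "max_fun M (F_filtration M E) u \<in> borel_measurable M"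
proof -
  have [measurable]: "cond_exp_op M (F_filtration M E) n u \<in> borel_measurable M" for n
    by (simp add: cond_exp_op_def)
  show ?thesis
    unfolding max_fun_def by measurable
qed

text \<open>The indices 1 and 2 contribute the mean and \<open>u\<close> itself. A lower bound for
  the supremum is enough, since only its positivity is at stake.\<close>

lemma max_fun_ge:
  assumes "u \<in> L1_sub M (F_infinity M E)"
  shows "AE x in M. ennreal \<bar>expectation u\<bar> \<le> max_fun M (F_filtration M E) u x
    \<and> ennreal \<bar>u x\<bar> \<le> max_fun M (F_filtration M E) u x"
proof -
  have "integrable M u"
    using assms by (simp add: L1_sub_def)
  have le: "ennreal \<bar>cond_exp_op M (F_filtration M E) n u x\<bar> \<le> max_fun M (F_filtration M E) u x"
    if "1 \<le> n" for n x
    unfolding max_fun_def using that by (intro SUP_upper) simp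
  show ?thesis
    using cond_exp_op_1 [OF \<open>integrable M u\<close>] cond_exp_op_ge_2 [OF assms order_refl]
  proof eventually_elim
    case (elim x)
    then show ?case
      using le [of 1 x] le [of 2 x] by simp
  qed
qed

lemma variation_fun_eq:
  assumes "u \<in> L1_sub M (F_infinity M E)"
  shows "AE x in M. variation_fun M (F_filtration M E) u x =
    ennreal (\<bar>expectation u\<bar> + \<bar>u x - expectation u\<bar>)"
proof -
  have "integrable M u"
    using assms by (simp add: L1_sub_def)
  \<comment> \<open>From \<open>n = 2\<close> on, consecutive operators are the same conditional
    expectation, so the tail of the series vanishes at every point, not just almost surely.\<close>
  have "variation_fun M (F_filtration M E) u x =
    (\<Sum>n<2. ennreal \<bar>cond_exp_op M (F_filtration M E) (Suc n) u x - cond_exp_op M (F_filtration M E) n u x\<bar>)" for x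
    unfolding variation_fun_def
    by (rule suminf_finite) (auto simp: cond_exp_op_def F_filtration_def)
  then have two_terms: "variation_fun M (F_filtration M E) u x =
    ennreal \<bar>cond_exp_op M (F_filtration M E) 1 u x\<bar> +
    ennreal \<bar>cond_exp_op M (F_filtration M E) 2 u x - cond_exp_op M (F_filtration M E) 1 u x\<bar>" for x
    by (simp add: numeral_2_eq_2 cond_exp_op_def)
  show ?thesis
    using cond_exp_op_1 [OF \<open>integrable M u\<close>] cond_exp_op_ge_2 [OF assms order_refl]
    by eventually_elim (simp add: two_terms)
qed

lemma expectation_two_valued:
  fixes u :: "'a \<Rightarrow> real"
  assumes "\<And>x. x \<in> space M \<Longrightarrow> u x = (if x \<in> E then a else b)"
  shows "expectation u = prob E * a + (1 - prob E) * b"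
proof -
  have "expectation u = expectation (\<lambda>x. if x \<in> E then a else b)"
    using assms by (rule Bochner_Integration.integral_cong [OF refl])
  then show ?thesis
    using has_bochner_integral_two_valued [of a b] by (simp add: has_bochner_integral_iff)
qed

lemma nn_integral_variation_fun:
  assumes u: "u \<in> L1_sub M (F_infinity M E)"
    and ab: "\<And>x. x \<in> space M \<Longrightarrow> u x = (if x \<in> E then a else b)"
  shows "(\<integral>\<^sup>+x. variation_fun M (F_filtration M E) u x \<partial>M) =
    ennreal (\<bar>prob E * a + (1 - prob E) * b\<bar> + 2 * prob E * (1 - prob E) * \<bar>a - b\<bar>)"
proof -
  define p m where "p = prob E" and "m = p * a + (1 - p) * b"
  have p: "0 \<le> p" "p \<le> 1"
    by (auto simp: p_def)
  have m: "expectation u = m"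
    using expectation_two_valued [OF ab] by (simp add: m_def p_def)
  \<comment> \<open>The deviations from the mean on the two atoms, weighted by \<open>p\<close> and
    \<open>1 - p\<close>, each contribute \<open>p * (1 - p) * \<bar>a - b\<bar>\<close>; this is
    the source of the factor 2.\<close>
  have "a - m = (1 - p) * (a - b)" "b - m = - (p * (a - b))"
    by (simp_all add: m_def algebra_simps)
  then have dev: "\<bar>a - m\<bar> = (1 - p) * \<bar>a - b\<bar>" "\<bar>b - m\<bar> = p * \<bar>a - b\<bar>"
    using p by (simp_all add: abs_mult)
  have "(\<integral>\<^sup>+x. variation_fun M (F_filtration M E) u x \<partial>M) =
      (\<integral>\<^sup>+x. ennreal (if x \<in> E then \<bar>m\<bar> + \<bar>a - m\<bar> else \<bar>m\<bar> + \<bar>b - m\<bar>) \<partial>M)"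
  proof (rule nn_integral_cong_AE)
    show "AE x in M. variation_fun M (F_filtration M E) u x =
        ennreal (if x \<in> E then \<bar>m\<bar> + \<bar>a - m\<bar> else \<bar>m\<bar> + \<bar>b - m\<bar>)"
      using variation_fun_eq [OF u] AE_space by eventually_elim (simp add: m ab)
  qed
  also have "\<dots> = ennreal (p * (\<bar>m\<bar> + \<bar>a - m\<bar>) + (1 - p) * (\<bar>m\<bar> + \<bar>b - m\<bar>))"
    unfolding p_def by (rule nn_integral_two_valued) auto
  also have "p * (\<bar>m\<bar> + \<bar>a - m\<bar>) + (1 - p) * (\<bar>m\<bar> + \<bar>b - m\<bar>) = \<bar>m\<bar> + 2 * p * (1 - p) * \<bar>a - b\<bar>"
    unfolding dev by (simp add: algebra_simps)
  finally show ?thesis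
    by (simp add: p_def m_def)
qed

text \<open>Turns an almost sure relation between two-valued functions into one between their
  values: a single good point in each atom suffices.\<close>

lemma AE_witness:
  assumes "AE x in M. P x" "A \<in> sets M" "0 < prob A"
  obtains x where "x \<in> A" "P x"
proof -
  have "\<exists>x\<in>A. P x"
  proof (rule ccontr)
    assume "\<not> (\<exists>x\<in>A. P x)"
    then have "AE x in M. x \<notin> A"
      using assms(1) by (auto elim: eventually_mono)
    then have "prob A = 0"
      using assms(2) by (simp add: prob_eq_0)
    then show False
      using assms(3) by simp
  qed
  then show thesis
    using that by blast
qed

lemma max_fun_pos_or_zero:
  assumes p: "0 < prob E" "prob E < 1" and g: "g \<in> L1_sub M (F_infinity M E)"
  shows "prob {x \<in> space M. max_fun M (F_filtration M E) g x > 0} = 1 \<or> (AE x in M. g x = 0)"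
proof -
  obtain a b where ab: "\<And>x. x \<in> space M \<Longrightarrow> g x = (if x \<in> E then a else b)"
    using F_infinity_measurable_two_valued g by (auto simp: L1_sub_def)
  note mean = expectation_two_valued [OF ab]
  show ?thesis
  proof (cases "a = 0 \<and> b = 0")
    case True
    then have "AE x in M. g x = 0"
      by (auto simp: ab)
    then show ?thesis ..
  next
    case False
    \<comment> \<open>If exactly one of \<open>a\<close>, \<open>b\<close> vanishes, the mean is a
      nonzero multiple of the other, because both atoms have positive probability.\<close>
    then have nz: "expectation g \<noteq> 0 \<or> a \<noteq> 0 \<and> b \<noteq> 0"
      using mean p by auto
    have "AE x in M. max_fun M (F_filtration M E) g x > 0"
      using max_fun_ge [OF g] AE_space
    proof eventually_elim
      case (elim x)
      then have "0 < ennreal \<bar>expectation g\<bar> \<or> 0 < ennreal \<bar>g x\<bar>"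
        using nz ab [of x] by auto
      then show ?case
        using elim by (meson less_le_trans)
    qed
    then have "prob {x \<in> space M. max_fun M (F_filtration M E) g x > 0} = 1"
      by (subst prob_Collect_eq_1) measurable
    then show ?thesis ..
  qed
qed

end

section \<open>Inequalities and equality cases for the values on the two atoms\<close>

lemma variation_bound_le_1:
  fixes p lam beta s t :: real
  assumes "0 < p" "p \<le> 1 / 2" "s \<le> beta * lam" "t \<le> beta * lam"
  shows "(3 - beta - 2 * p) * lam \<le>
    \<bar>p * (lam / p - s) + (1 - p) * (- t)\<bar> + 2 * p * (1 - p) * \<bar>lam / p - s - (- t)\<bar>"
proof -
  \<comment> \<open>Writing \<open>lam\<close> as \<open>p * q\<close> removes the division, so that
    the identities below are polynomial.\<close>
  define q where "q = lam / p"
  have lam: "lam = p * q"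
    using assms(1) by (simp add: q_def)
  \<comment> \<open>These are the coefficients of \<open>s\<close> and \<open>t\<close> once the
    absolute values are dropped. They are nonnegative for \<open>p <= 1 / 2\<close> and sum to 1,
    which leaves exactly \<open>beta * lam\<close> to subtract.\<close>
  have "p * (3 - 2 * p) * s \<le> p * (3 - 2 * p) * (beta * lam)"
    using assms by (intro mult_left_mono) auto
  moreover have "(1 - p) * (1 - 2 * p) * t \<le> (1 - p) * (1 - 2 * p) * (beta * lam)"
    using assms by (intro mult_left_mono) auto
  moreover have "p * (lam / p - s) + (1 - p) * (- t) + 2 * p * (1 - p) * (lam / p - s - (- t)) =
      (3 - 2 * p) * lam - p * (3 - 2 * p) * s - (1 - p) * (1 - 2 * p) * t"
    unfolding q_def [symmetric] lam by (simp add: algebra_simps)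
  moreover have "(3 - beta - 2 * p) * lam =
      (3 - 2 * p) * lam - p * (3 - 2 * p) * (beta * lam) - (1 - p) * (1 - 2 * p) * (beta * lam)"
    by (simp add: algebra_simps)
  ultimately have "(3 - beta - 2 * p) * lam \<le>
      p * (lam / p - s) + (1 - p) * (- t) + 2 * p * (1 - p) * (lam / p - s - (- t))"
    by linarith
  also have "\<dots> \<le> \<bar>p * (lam / p - s) + (1 - p) * (- t)\<bar> + 2 * p * (1 - p) * \<bar>lam / p - s - (- t)\<bar>"
    using assms by (intro add_mono mult_left_mono abs_ge_self) auto
  finally show ?thesis .
qed

lemma variation_bound_ge_1:
  fixes p lam beta s t :: real
  assumes "0 < p" "p \<le> 1 / 2" "s \<le> beta * lam"
  shows "2 * (1 - p * beta) * lam \<le>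
    \<bar>p * (lam / p - s) + (1 - p) * (- t)\<bar> + 2 * p * (1 - p) * \<bar>lam / p - s - (- t)\<bar>"
proof -
  define m where "m = p * (lam / p - s) + (1 - p) * (- t)"
  define q where "q = lam / p"
  have lam: "lam = p * q"
    using assms(1) by (simp add: q_def)
  \<comment> \<open>Once \<open>t\<close> has cancelled, the weighted sum is
    \<open>2 * lam - 2 * p * s\<close>.\<close>
  have "2 * p * s \<le> 2 * p * (beta * lam)"
    using assms by (intro mult_left_mono) auto
  \<comment> \<open>Since \<open>2 * p \<le> 1\<close>, the mean may be weighted by \<open>2 * p\<close>, the factor for which \<open>t\<close> cancels.\<close>
  then have "2 * (1 - p * beta) * lam \<le> 2 * p * m + 2 * p * (1 - p) * (lam / p - s - (- t))"
    unfolding m_def q_def [symmetric] lam by (simp add: algebra_simps)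
  also have "\<dots> \<le> 1 * \<bar>m\<bar> + 2 * p * (1 - p) * \<bar>lam / p - s - (- t)\<bar>"
  proof (intro add_mono)
    have "2 * p * m \<le> 2 * p * \<bar>m\<bar>"
      using assms by (intro mult_left_mono) auto
    also have "\<dots> \<le> 1 * \<bar>m\<bar>"
      using assms by (intro mult_right_mono) auto
    finally show "2 * p * m \<le> 1 * \<bar>m\<bar>" .
    show "2 * p * (1 - p) * (lam / p - s - (- t)) \<le> 2 * p * (1 - p) * \<bar>lam / p - s - (- t)\<bar>"
      using assms by (intro mult_left_mono) auto
  qed
  finally show ?thesis
    by (simp add: m_def)
qed

text \<open>With both values of \<open>k\<close> equal to \<open>beta * lam\<close>, the mean
  \<open>(1 - beta) * lam\<close> is nonnegative and the values of \<open>h\<close> differ by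
  \<open>lam / p\<close>, so both absolute values open without loss.\<close>

lemma variation_eq_le_1:
  fixes p lam beta :: real
  assumes "0 < p" "p \<le> 1 / 2" "0 < lam" "beta \<le> 1"
  shows "\<bar>p * (lam / p - beta * lam) + (1 - p) * (- (beta * lam))\<bar>
      + 2 * p * (1 - p) * \<bar>lam / p - beta * lam - (- (beta * lam))\<bar> = (3 - beta - 2 * p) * lam"
proof -
  have "p * (lam / p - beta * lam) + (1 - p) * (- (beta * lam)) = (1 - beta) * lam"
    using assms by (simp add: field_simps)
  then show ?thesis
    using assms by (simp add: abs_mult) (simp add: field_simps)
qed

text \<open>This \<open>t\<close> balances the two atoms: \<open>p * (lam / p - beta * lam)\<close>
  and \<open>(1 - p) * t\<close> both equal \<open>(1 - p * beta) * lam\<close>. The mean therefore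
  vanishes, and only the oscillation remains.\<close>

lemma variation_eq_ge_1:
  fixes p lam beta :: real
  assumes "0 < p" "p \<le> 1 / 2" "0 < lam" "beta \<le> 1 / p"
  defines "t \<equiv> (1 - p * beta) * lam / (1 - p)"
  shows "\<bar>p * (lam / p - beta * lam) + (1 - p) * (- t)\<bar>
      + 2 * p * (1 - p) * \<bar>lam / p - beta * lam - (- t)\<bar> = 2 * (1 - p * beta) * lam"
proof -
  have pb: "p * beta \<le> 1"
    using assms by (simp add: field_simps)
  have t: "(1 - p) * t = (1 - p * beta) * lam" "0 \<le> t"
    using assms pb by (simp_all add: t_def)
  have ps: "p * (lam / p - beta * lam) = (1 - p * beta) * lam"
    using assms(1) by (simp add: field_simps)
  have "0 \<le> lam / p - beta * lam"
    using mult_right_mono [of beta "1 / p" lam] assms by simp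
  then have "\<bar>lam / p - beta * lam - (- t)\<bar> = lam / p - beta * lam + t"
    using t by simp
  moreover have "2 * p * (1 - p) * (x + t) = 2 * (1 - p) * (p * x) + 2 * p * ((1 - p) * t)" for x
    by (simp add: algebra_simps)
  ultimately show ?thesis
    using t by (simp add: ps) (simp add: algebra_simps)
qed

section \<open>Lower bounds and extremal decompositions\<close>

theorem proposition3p10:
  fixes M :: "'a measure" and E :: "'a set" and p lam :: real and f :: "'a \<Rightarrow> real"
  assumes "prob_space M"
    and "E \<in> sets M"
    and "p = measure M E" and "0 < p" and "p \<le> 1 / 2"
    and "lam > 0"
    and "f = (\<lambda>x. lam / p * indicat_real E x)"
  shows "(\<integral>x. \<bar>f x\<bar> \<partial>M) = lam \<and>
    (\<forall>beta\<in>{0..1 / p}. \<forall>g h k.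
      g \<in> L1_sub M (F_infinity M E) \<longrightarrow>
      h \<in> L1_sub M (F_infinity M E) \<longrightarrow>
      k \<in> L1_sub M (F_infinity M E) \<longrightarrow>
      (AE x in M. f x = g x + h x + k x) \<longrightarrow>
      (AE x in M. 0 \<le> k x \<and> k x \<le> beta * lam) \<longrightarrow>
      measure M {x \<in> space M. max_fun M (F_filtration M E) g x > 0} = 1 \<or>
      ((AE x in M. g x = 0) \<and>
       (beta \<le> 1 \<longrightarrow>
         (\<integral>\<^sup>+x. variation_fun M (F_filtration M E) h x \<partial>M) \<ge> ennreal ((3 - beta - 2 * p) * lam)) \<and>
       (1 \<le> beta \<longrightarrow>
         (\<integral>\<^sup>+x. variation_fun M (F_filtration M E) h x \<partial>M) \<ge> ennreal (2 * (1 - p * beta) * lam)))) \<and>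
    (\<forall>beta\<in>{0..1 / p}. \<exists>g h k.
      (\<forall>x. g x = 0) \<and>
      h \<in> L1_sub M (F_infinity M E) \<and>
      k \<in> L1_sub M (F_infinity M E) \<and>
      (AE x in M. f x = g x + h x + k x) \<and>
      (AE x in M. 0 \<le> k x \<and> k x \<le> beta * lam) \<and>
      (beta \<le> 1 \<longrightarrow>
        (\<integral>\<^sup>+x. variation_fun M (F_filtration M E) h x \<partial>M) = ennreal ((3 - beta - 2 * p) * lam)) \<and>
      (1 \<le> beta \<longrightarrow>
        (\<integral>\<^sup>+x. variation_fun M (F_filtration M E) h x \<partial>M) = ennreal (2 * (1 - p * beta) * lam)))"
proof -
  interpret prob_space M by fact
  interpret prob_space_event M E
    by unfold_locales fact
  have p: "0 < p" "p \<le> 1 / 2" "prob E = p" "prob E < 1"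
    using assms by auto
  note f = assms(7)
  have "f = (\<lambda>x. if x \<in> E then lam / p else 0)"
    by (auto simp: f)
  then have norm_f: "(\<integral>x. \<bar>f x\<bar> \<partial>M) = lam"
    using expectation_two_valued [of "\<lambda>x. \<bar>f x\<bar>" "lam / p" 0] p \<open>lam > 0\<close> by simp
  have lower: "prob {x \<in> space M. max_fun M (F_filtration M E) g x > 0} = 1 \<or>
      ((AE x in M. g x = 0) \<and>
       (beta \<le> 1 \<longrightarrow>
         (\<integral>\<^sup>+x. variation_fun M (F_filtration M E) h x \<partial>M) \<ge> ennreal ((3 - beta - 2 * p) * lam)) \<and>
       (1 \<le> beta \<longrightarrow>
         (\<integral>\<^sup>+x. variation_fun M (F_filtration M E) h x \<partial>M) \<ge> ennreal (2 * (1 - p * beta) * lam)))"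
    if g: "g \<in> L1_sub M (F_infinity M E)" and h: "h \<in> L1_sub M (F_infinity M E)"
      and k: "k \<in> L1_sub M (F_infinity M E)"
      and fghk: "AE x in M. f x = g x + h x + k x"
      and bnd: "AE x in M. 0 \<le> k x \<and> k x \<le> beta * lam" for beta g h k
    using max_fun_pos_or_zero [OF _ p(4) g]
  proof
    assume g0: "AE x in M. g x = 0"
    obtain a b where ab: "\<And>x. x \<in> space M \<Longrightarrow> h x = (if x \<in> E then a else b)"
      using F_infinity_measurable_two_valued h by (auto simp: L1_sub_def)
    obtain s t where st: "\<And>x. x \<in> space M \<Longrightarrow> k x = (if x \<in> E then s else t)"
      using F_infinity_measurable_two_valued k by (auto simp: L1_sub_def)
    have ae: "AE x in M. f x = h x + k x \<and> k x \<le> beta * lam"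
      using fghk g0 bnd by eventually_elim auto
    \<comment> \<open>One point in each atom determines \<open>a\<close> and \<open>b\<close> from
      \<open>s\<close> and \<open>t\<close> and transfers the bound on \<open>k\<close> to its
      values.\<close>
    obtain x where x: "x \<in> E" "f x = h x + k x \<and> k x \<le> beta * lam"
      using AE_witness [OF ae E_sets] p by auto
    obtain y where y: "y \<in> space M - E" "f y = h y + k y \<and> k y \<le> beta * lam"
      using AE_witness [OF ae sets.compl_sets [OF E_sets]] p prob_compl_E by auto
    have "a = lam / p - s" "s \<le> beta * lam"
      using x ab [of x] st [of x] E_subset by (auto simp: f)
    moreover have "b = - t" "t \<le> beta * lam"
      using y ab [of y] st [of y] by (auto simp: f)
    moreover have "(\<integral>\<^sup>+x. variation_fun M (F_filtration M E) h x \<partial>M) =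
        ennreal (\<bar>p * a + (1 - p) * b\<bar> + 2 * p * (1 - p) * \<bar>a - b\<bar>)"
      using nn_integral_variation_fun [OF h ab] by (simp only: p(3))
    ultimately show ?thesis
      using g0 variation_bound_le_1 [of p s beta lam t] variation_bound_ge_1 [of p s beta lam t] p(1,2)
      by (simp del: ennreal_plus add: ennreal_leI)
  qed (use p in auto)
  have sharp: "\<exists>g h k.
      (\<forall>x. g x = 0) \<and>
      h \<in> L1_sub M (F_infinity M E) \<and>
      k \<in> L1_sub M (F_infinity M E) \<and>
      (AE x in M. f x = g x + h x + k x) \<and>
      (AE x in M. 0 \<le> k x \<and> k x \<le> beta * lam) \<and>
      (beta \<le> 1 \<longrightarrow>
        (\<integral>\<^sup>+x. variation_fun M (F_filtration M E) h x \<partial>M) = ennreal ((3 - beta - 2 * p) * lam)) \<and>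
      (1 \<le> beta \<longrightarrow>
        (\<integral>\<^sup>+x. variation_fun M (F_filtration M E) h x \<partial>M) = ennreal (2 * (1 - p * beta) * lam))"
    if beta: "0 \<le> beta" "beta \<le> 1 / p" for beta
  proof -
    \<comment> \<open>The value of \<open>k\<close> off \<open>E\<close>: the largest admissible one
      if \<open>beta <= 1\<close>, otherwise the one that gives \<open>h\<close> mean zero.\<close>
    define t where "t = (if beta \<le> 1 then beta * lam else (1 - p * beta) * lam / (1 - p))"
    define h where "h = (\<lambda>x. if x \<in> E then lam / p - beta * lam else - t)"
    define k where "k = (\<lambda>x. if x \<in> E then beta * lam else t)"
    have pb: "p * beta \<le> 1"
      using beta p by (simp add: field_simps)
    have t: "0 \<le> t \<and> t \<le> beta * lam"
    proof (cases "beta \<le> 1")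
      case False
      \<comment> \<open>After cancelling \<open>lam\<close>, this inequality says
        \<open>1 <= beta\<close>; it keeps the balancing \<open>t\<close> admissible.\<close>
      then have "(1 - p * beta) * lam \<le> (beta * (1 - p)) * lam"
        using \<open>lam > 0\<close> by (intro mult_right_mono) (auto simp: algebra_simps)
      then show ?thesis
        using False p \<open>lam > 0\<close> pb by (simp add: t_def pos_divide_le_eq mult_ac)
    qed (use beta \<open>lam > 0\<close> in \<open>simp add: t_def\<close>)
    have h: "h \<in> L1_sub M (F_infinity M E)"
      unfolding h_def by (rule two_valued_L1_sub)
    have V: "(\<integral>\<^sup>+x. variation_fun M (F_filtration M E) h x \<partial>M) =
        ennreal (\<bar>p * (lam / p - beta * lam) + (1 - p) * (- t)\<bar>
          + 2 * p * (1 - p) * \<bar>lam / p - beta * lam - (- t)\<bar>)"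
      using nn_integral_variation_fun [OF h, of "lam / p - beta * lam" "- t"] p(3)
      by (simp add: h_def)
    \<comment> \<open>At \<open>beta = 1\<close> both branches give \<open>t = lam\<close>, so the
      same decomposition attains both formulas there.\<close>
    have "t = (1 - p * beta) * lam / (1 - p)" if "1 \<le> beta"
      using that p by (cases "beta = 1") (auto simp: t_def)
    then have "1 \<le> beta \<longrightarrow>
        (\<integral>\<^sup>+x. variation_fun M (F_filtration M E) h x \<partial>M) = ennreal (2 * (1 - p * beta) * lam)"
      using V variation_eq_ge_1 [OF p(1,2) \<open>lam > 0\<close> beta(2)] by simp
    moreover have "beta \<le> 1 \<longrightarrow>
        (\<integral>\<^sup>+x. variation_fun M (F_filtration M E) h x \<partial>M) = ennreal ((3 - beta - 2 * p) * lam)"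
      using V variation_eq_le_1 [OF p(1,2) \<open>lam > 0\<close>, of beta] by (simp add: t_def)
    moreover have "k \<in> L1_sub M (F_infinity M E)"
      unfolding k_def by (rule two_valued_L1_sub)
    moreover have "f x = 0 + h x + k x \<and> 0 \<le> k x \<and> k x \<le> beta * lam" for x
      using t beta \<open>lam > 0\<close> by (simp add: f h_def k_def)
    ultimately show ?thesis
      using h by (intro exI [of _ "\<lambda>_. 0"] exI [of _ h] exI [of _ k]) auto
  qed
  show ?thesis
    using norm_f lower sharp by (intro conjI ballI allI impI) auto
qed

end
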